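(* For every $c_1>c_2>1$, $0<\alpha<1$, $\Delta>0$ there exists $\kappa>0$ such that every $(c_1,c_2,\alpha)$-graph $G$ on $n$ vertices of maximum degree at most $\Delta$ contains all graphs with at most $n/\log^{\kappa}n$ vertices and edges as minors.
   Context: Graphs are finite and simple. For reals $c_1>c_2>1$, $0<\alpha<1$, a graph $G=(V,E)$ on $n$ vertices is a $(c_1,c_2,\alpha)$-graph if (1) $\frac{|E|}{|V|}\ge c_1$, and (2) every nonempty vertex subset $W\subset V$ of size $|W|\le\alpha n$ spans less than $c_2|W|$ edges (an edge is spanned by $W$ if both its endpoints lie in $W$). A graph has "at most $x$ vertices and edges" if it has at most $x$ vertices and at most $x$ edges. Here $\log^{\kappa}n=(\log n)^{\kappa}$, with $\log$ the natural logarithm. A graph $G$ contains a graph $H$ with vertex set $\{u_1,\ldots,u_t\}$ as a minor if there are pairwise disjoint vertex subsets $V_1,\ldots,V_t$ of $G$, each spanning a (nonempty) connected subgraph of $G$, such that whenever $(u_i,u_j)$ is an edge of $H$, $G$ has an edge between $V_i$ and $V_j$. *)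

theory Defs
  imports
    Complex_Main
    "HOL-Library.Disjoint_Sets"
    "Graph_Theory.Pair_Digraph"
    "Graph_Theory.Digraph_Component"
begin

text \<open>
  A finite simple graph is a \<^locale>\<open>pair_graph\<close>: a finite, loop-free, symmetric set of arcs. Each
  undirected edge is represented by two opposite arcs; edges are therefore counted as unordered
  pairs, and the degree of a vertex is its out-degree.
\<close>

definition edges :: "'a pair_pre_digraph \<Rightarrow> 'a set set" where
  "edges G = {{u, v} | u v. (u, v) \<in> parcs G}"

definition spanned_edges :: "'a pair_pre_digraph \<Rightarrow> 'a set \<Rightarrow> 'a set set" where
  "spanned_edges G W = {e \<in> edges G. e \<subseteq> W}"

text \<open>
  For the graph without vertices the quotient below is \<open>0\<close>, so that graph is excluded whenever
  \<open>c1 > 0\<close>.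
\<close>

definition c1_c2_alpha_graph :: "real \<Rightarrow> real \<Rightarrow> real \<Rightarrow> 'a pair_pre_digraph \<Rightarrow> bool" where
  "c1_c2_alpha_graph c1 c2 \<alpha> G \<longleftrightarrow>
     pair_graph G \<and>
     real (card (edges G)) / real (card (pverts G)) \<ge> c1 \<and>
     (\<forall>W. W \<subseteq> pverts G \<and> W \<noteq> {} \<and> real (card W) \<le> \<alpha> * real (card (pverts G)) \<longrightarrow>
        real (card (spanned_edges G W)) < c2 * real (card W))"

definition max_degree_at_most :: "'a pair_pre_digraph \<Rightarrow> real \<Rightarrow> bool" where
  "max_degree_at_most G d \<longleftrightarrow> (\<forall>v\<in>pverts G. real (out_degree (with_proj G) v) \<le> d)"

text \<open>
  \<open>B u\<close> is the branch set of the vertex \<open>u\<close> of \<open>H\<close>. The library notion of connectedness requires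
  at least one vertex, so branch sets are nonempty. The qualified name is needed because
  \<open>connected\<close> is also the topological notion.
\<close>

definition has_minor :: "'a pair_pre_digraph \<Rightarrow> 'b pair_pre_digraph \<Rightarrow> bool" where
  "has_minor G H \<longleftrightarrow>
     (\<exists>B :: 'b \<Rightarrow> 'a set.
        (\<forall>u\<in>pverts H. B u \<subseteq> pverts G \<and> Digraph_Component.connected (with_proj G \<restriction> B u)) \<and>
        disjoint_family_on B (pverts H) \<and>
        (\<forall>u v. (u, v) \<in> parcs H \<longrightarrow> (\<exists>x\<in>B u. \<exists>y\<in>B v. (x, y) \<in> parcs G)))"

end

theory Submission
  imports Defs
begin

text \<open>
  A locally sparse graph of bounded degree contains a linear-size vertex expander. In an expander
  any few vertices can be joined by a connected set of logarithmic size, since balls grow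
  exponentially until they exceed half of the graph and so meet; this persists after deleting a
  small set of vertices together with the parts that no longer expand. Branch sets are embedded
  one at a time in this way, discarding those that get cut off from the unused vertices. What is
  discarded has most of its neighbourhood inside the current branch sets, so by expansion it stays
  small. A branch set costs \<open>O(log n)\<close> vertices per incident edge, which leaves room for
  \<open>O(n / log n)\<close> vertices and edges.
\<close>

section \<open>Connected sets and ball growth in expanding relations\<close>

text \<open>Paths may not leave \<open>C\<close>, so this is connectedness of the subgraph induced
  by \<open>C\<close>, stated for a bare relation. Nonemptiness matches the library notion used for
  branch sets.\<close>

definition rel_connected :: "'a rel \<Rightarrow> 'a set \<Rightarrow> bool" where
  "rel_connected E C \<longleftrightarrow> C \<noteq> {} \<and> (\<forall>x\<in>C. \<forall>y\<in>C. (x, y) \<in> rtrancl_on C E)"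

definition nbhd :: "'a rel \<Rightarrow> 'a set \<Rightarrow> 'a set \<Rightarrow> 'a set" where
  "nbhd E U X = {y \<in> U - X. \<exists>x\<in>X. (x, y) \<in> E}"

definition expander :: "'a rel \<Rightarrow> 'a set \<Rightarrow> real \<Rightarrow> bool" where
  "expander E U \<gamma> \<longleftrightarrow>
     (\<forall>X\<subseteq>U. 2 * card X \<le> card U \<longrightarrow> \<gamma> * real (card X) \<le> real (card (nbhd E U X)))"

lemma rel_connected_singleton: "rel_connected E {x}"
  by (auto simp: rel_connected_def)

text \<open>Any two points are joined by a walk through the common vertex \<open>w\<close>.\<close>

lemma rel_connected_Union:
  assumes "\<C> \<noteq> {}" and "\<And>C. C \<in> \<C> \<Longrightarrow> rel_connected E C \<and> w \<in> C"
  shows "rel_connected E (\<Union>\<C>)"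
  unfolding rel_connected_def
proof (intro conjI ballI)
  show "\<Union>\<C> \<noteq> {}" using assms by blast
next
  fix x y assume "x \<in> \<Union>\<C>" "y \<in> \<Union>\<C>"
  then obtain C D where "C \<in> \<C>" "x \<in> C" "D \<in> \<C>" "y \<in> D" by blast
  then have "(x, w) \<in> rtrancl_on C E" "(w, y) \<in> rtrancl_on D E"
    using assms(2) by (auto simp: rel_connected_def)
  moreover have "rtrancl_on C E \<subseteq> rtrancl_on (\<Union>\<C>) E" "rtrancl_on D E \<subseteq> rtrancl_on (\<Union>\<C>) E"
    using \<open>C \<in> \<C>\<close> \<open>D \<in> \<C>\<close> by (auto intro: rtrancl_on_mono[rotated 2])
  ultimately show "(x, y) \<in> rtrancl_on (\<Union>\<C>) E"
    by (blast intro: rtrancl_on_trans)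
qed

lemma rel_connected_insert:
  assumes "rel_connected E C" "x \<in> C" "(x, y) \<in> E" "(y, x) \<in> E"
  shows "rel_connected E (insert y C)"
proof -
  have "rel_connected E {x, y}"
    using assms(3,4) unfolding rel_connected_def
    by (auto intro: rtrancl_on_into_rtrancl_on)
  then have "rel_connected E (\<Union>{C, {x, y}})"
    using assms(1,2) by (intro rel_connected_Union[where w = x]) auto
  moreover have "\<Union>{C, {x, y}} = insert y C" using assms(2) by auto
  ultimately show ?thesis by simp
qed

lemma finite_nbhd: "finite U \<Longrightarrow> finite (nbhd E U X)"
  by (simp add: nbhd_def)

text \<open>\<open>X\<close> plays the ball of radius \<open>k\<close> around \<open>w\<close>:
  adding the neighbourhood multiplies its size by at least \<open>1 + \<beta>\<close> as long as
  expansion applies. The threshold \<open>m\<close> is kept apart from \<open>card F\<close> because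
  \<open>F\<close> will be the free part of a larger expander, whose size sets the range of
  expansion.\<close>

lemma ball_growth:
  fixes \<beta> :: real
  assumes "finite F" "sym E" "\<beta> > 0" "w \<in> F"
    and expand: "\<And>X. X \<subseteq> F \<Longrightarrow> 2 * card X \<le> m \<Longrightarrow> \<beta> * real (card X) \<le> real (card (nbhd E F X))"
  shows "\<exists>X\<subseteq>F. (\<forall>y\<in>X. \<exists>C\<subseteq>F. rel_connected E C \<and> w \<in> C \<and> y \<in> C \<and> card C \<le> Suc k) \<and>
           (m < 2 * card X \<or> (1 + \<beta>) ^ k \<le> real (card X))"
proof (induction k)
  case 0
  show ?case
    using \<open>w \<in> F\<close> rel_connected_singleton[of E w]
    by (intro exI[of _ "{w}"]) (auto intro!: exI[of _ "{w}"])
next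
  case (Suc k)
  then obtain X where X: "X \<subseteq> F"
    "\<And>y. y \<in> X \<Longrightarrow> \<exists>C\<subseteq>F. rel_connected E C \<and> w \<in> C \<and> y \<in> C \<and> card C \<le> Suc k"
    "m < 2 * card X \<or> (1 + \<beta>) ^ k \<le> real (card X)"
    by blast
  show ?case
  proof (cases "m < 2 * card X")
    case True
    then show ?thesis using X(1,2) by (meson le_SucI)
  next
    case False
    define Y where "Y = X \<union> nbhd E F X"
    have fin: "finite X" "finite (nbhd E F X)"
      using X(1) \<open>finite F\<close> by (auto intro: finite_subset finite_nbhd)
    have "card Y = card X + card (nbhd E F X)"
      unfolding Y_def using fin by (intro card_Un_disjoint) (auto simp: nbhd_def)
    moreover have "\<beta> * real (card X) \<le> real (card (nbhd E F X))"
      using False X(1) by (intro expand) auto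
    ultimately have "(1 + \<beta>) * real (card X) \<le> real (card Y)"
      by (simp add: algebra_simps)
    moreover have "(1 + \<beta>) ^ Suc k \<le> (1 + \<beta>) * real (card X)"
      using False X(3) \<open>\<beta> > 0\<close> by simp
    ultimately have "(1 + \<beta>) ^ Suc k \<le> real (card Y)" by linarith
    moreover have "\<exists>C\<subseteq>F. rel_connected E C \<and> w \<in> C \<and> y \<in> C \<and> card C \<le> Suc (Suc k)"
      if "y \<in> Y" for y
    proof (cases "y \<in> X")
      case True
      then show ?thesis using X(2) by (meson le_SucI)
    next
      case False
      then obtain x where x: "x \<in> X" "(x, y) \<in> E" "y \<in> F"
        using \<open>y \<in> Y\<close> by (auto simp: Y_def nbhd_def)
      then obtain C where C: "C \<subseteq> F" "rel_connected E C" "w \<in> C" "x \<in> C" "card C \<le> Suc k"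
        using X(2) by blast
      have "rel_connected E (insert y C)"
        using rel_connected_insert[OF C(2,4) x(2)] \<open>sym E\<close> x(2) by (auto dest: symD)
      moreover have "card (insert y C) \<le> Suc (Suc k)"
        using card_insert_le_m1[of "Suc (Suc k)" C y] C(5) by simp
      ultimately show ?thesis using C x(3) by (intro exI[of _ "insert y C"]) auto
    qed
    moreover have "Y \<subseteq> F" using X(1) by (auto simp: Y_def nbhd_def)
    ultimately show ?thesis by blast
  qed
qed

text \<open>Balls of radius \<open>\<rho>\<close> have more than \<open>m / 2\<close> vertices, and
  \<open>F\<close> has at most \<open>m\<close>, so any two of them meet. Fixing one vertex
  \<open>w0\<close> of \<open>W\<close>, a star of connections from \<open>w0\<close> to every
  vertex of \<open>W\<close> costs at most \<open>2 * \<rho> + 2\<close> vertices each.\<close>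

lemma connecting_set:
  fixes \<beta> :: real
  assumes "finite F" "sym E" "\<beta> > 0" "card F \<le> m" "real m \<le> (1 + \<beta>) ^ \<rho>"
    and expand: "\<And>X. X \<subseteq> F \<Longrightarrow> 2 * card X \<le> m \<Longrightarrow> \<beta> * real (card X) \<le> real (card (nbhd E F X))"
    and W: "W \<subseteq> F" "W \<noteq> {}"
  shows "\<exists>C\<subseteq>F. rel_connected E C \<and> W \<subseteq> C \<and> card C \<le> (2 * \<rho> + 2) * card W"
proof -
  have pos: "m > 0"
    using assms(1,4) W by (metis card_gt_0_iff finite_subset le_zero_eq neq0_conv subset_empty)
  have big: "\<exists>X\<subseteq>F. (\<forall>y\<in>X. \<exists>C\<subseteq>F. rel_connected E C \<and> w \<in> C \<and> y \<in> C \<and> card C \<le> Suc \<rho>) \<and>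
      m < 2 * card X" if w: "w \<in> F" for w
  proof -
    from ball_growth[OF assms(1-3) w expand, of m \<rho>] obtain X where X: "X \<subseteq> F"
      "\<forall>y\<in>X. \<exists>C\<subseteq>F. rel_connected E C \<and> w \<in> C \<and> y \<in> C \<and> card C \<le> Suc \<rho>"
      "m < 2 * card X \<or> (1 + \<beta>) ^ \<rho> \<le> real (card X)"
      by blast
    from X(3) have "m < 2 * card X"
    proof
      assume "(1 + \<beta>) ^ \<rho> \<le> real (card X)"
      then have "m \<le> card X" using assms(5) by linarith
      then show ?thesis using pos by simp
    qed
    then show ?thesis using X by blast
  qed
  obtain w0 where w0: "w0 \<in> W" using W by blast
  obtain X0 where X0: "X0 \<subseteq> F" "m < 2 * card X0"
    "\<And>y. y \<in> X0 \<Longrightarrow> \<exists>C\<subseteq>F. rel_connected E C \<and> w0 \<in> C \<and> y \<in> C \<and> card C \<le> Suc \<rho>"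
    using big[of w0] w0 W by blast
  have "\<exists>C\<subseteq>F. rel_connected E C \<and> w0 \<in> C \<and> w \<in> C \<and> card C \<le> 2 * \<rho> + 2" if "w \<in> W" for w
  proof -
    obtain X where X: "X \<subseteq> F" "m < 2 * card X"
      "\<And>y. y \<in> X \<Longrightarrow> \<exists>C\<subseteq>F. rel_connected E C \<and> w \<in> C \<and> y \<in> C \<and> card C \<le> Suc \<rho>"
      using big[of w] \<open>w \<in> W\<close> W by blast
    have "X0 \<inter> X \<noteq> {}"
    proof
      assume "X0 \<inter> X = {}"
      then have "card (X0 \<union> X) = card X0 + card X"
        using X(1) X0(1) assms(1) by (intro card_Un_disjoint) (auto intro: finite_subset)
      moreover have "card (X0 \<union> X) \<le> card F"
        using X(1) X0(1) assms(1) by (intro card_mono) auto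
      ultimately show False using X(2) X0(2) assms(4) by linarith
    qed
    then obtain y where y: "y \<in> X0" "y \<in> X" by blast
    obtain C where C: "C \<subseteq> F" "rel_connected E C" "w0 \<in> C" "y \<in> C" "card C \<le> Suc \<rho>"
      using X0(3)[OF y(1)] by blast
    obtain D where D: "D \<subseteq> F" "rel_connected E D" "w \<in> D" "y \<in> D" "card D \<le> Suc \<rho>"
      using X(3)[OF y(2)] by blast
    have "rel_connected E (\<Union>{C, D})"
      using C D by (intro rel_connected_Union[where w = y]) auto
    moreover have "card (C \<union> D) \<le> 2 * \<rho> + 2"
      using card_Un_le[of C D] C(5) D(5) by linarith
    ultimately show ?thesis using C D by (intro exI[of _ "C \<union> D"]) auto
  qed
  then obtain C where C: "\<And>w. w \<in> W \<Longrightarrow>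
      C w \<subseteq> F \<and> rel_connected E (C w) \<and> w0 \<in> C w \<and> w \<in> C w \<and> card (C w) \<le> 2 * \<rho> + 2"
    by metis
  have "rel_connected E (\<Union>(C ` W))"
    using C W(2) by (intro rel_connected_Union[where w = w0]) auto
  moreover have "card (\<Union>(C ` W)) \<le> (2 * \<rho> + 2) * card W"
  proof -
    have "finite W" using W(1) assms(1) by (rule finite_subset)
    then have "card (\<Union>(C ` W)) \<le> (\<Sum>w\<in>W. card (C w))" by (rule card_UN_le)
    also have "\<dots> \<le> (\<Sum>w\<in>W. 2 * \<rho> + 2)" using C by (intro sum_mono) blast
    finally show ?thesis by (simp add: mult.commute)
  qed
  moreover have "\<Union>(C ` W) \<subseteq> F" "W \<subseteq> \<Union>(C ` W)" using C by blast+
  ultimately show ?thesis by blast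
qed

section \<open>Partial minor models and their total size\<close>

text \<open>The size budget refers to the full degree of \<open>u\<close> in \<open>A\<close>, not
  to its neighbours in \<open>S\<close>, so it stays valid when \<open>S\<close> grows or
  shrinks.\<close>

definition partial_model ::
  "'a rel \<Rightarrow> 'a set \<Rightarrow> 'b rel \<Rightarrow> nat \<Rightarrow> 'b set \<Rightarrow> ('b \<Rightarrow> 'a set) \<Rightarrow> bool" where
  "partial_model E U A L S B \<longleftrightarrow>
     (\<forall>u\<in>S. B u \<subseteq> U \<and> rel_connected E (B u) \<and> card (B u) \<le> L * Suc (card (A `` {u}))) \<and>
     disjoint_family_on B S \<and>
     (\<forall>u\<in>S. \<forall>v\<in>S. (u, v) \<in> A \<longrightarrow> (\<exists>x\<in>B u. \<exists>y\<in>B v. (x, y) \<in> E))"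

lemma partial_model_mono:
  assumes "partial_model E U A L S B" "S' \<subseteq> S"
  shows "partial_model E U A L S' B"
  using assms disjoint_family_on_mono[of S' S B] unfolding partial_model_def
  by (meson subset_iff)

text \<open>Summing the budgets over all of \<open>V\<close> turns the degrees into the number of
  arcs of \<open>A\<close>.\<close>

lemma partial_model_card:
  assumes "partial_model E U A L S B" "S \<subseteq> V" "finite V" "finite A" "A \<subseteq> V \<times> V"
  shows "card (\<Union>(B ` S)) \<le> L * (card V + card A)"
proof -
  have "finite S" using assms by (auto intro: finite_subset)
  then have "card (\<Union>(B ` S)) \<le> (\<Sum>u\<in>S. card (B u))" by (rule card_UN_le)
  also have "\<dots> \<le> (\<Sum>u\<in>S. L * Suc (card (A `` {u})))"
    using assms(1) by (intro sum_mono) (auto simp: partial_model_def)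
  also have "\<dots> \<le> (\<Sum>u\<in>V. L * Suc (card (A `` {u})))"
    using assms by (intro sum_mono2) auto
  also have "\<dots> = L * (card V + (\<Sum>u\<in>V. card (A `` {u})))"
    by (simp add: sum_distrib_left[symmetric] sum.distrib algebra_simps)
  also have "(\<Sum>u\<in>V. card (A `` {u})) = card (SIGMA u:V. A `` {u})"
    using assms by (intro card_SigmaI[symmetric]) auto
  also have "(SIGMA u:V. A `` {u}) = A" using assms(5) by auto
  finally show ?thesis .
qed

text \<open>Symmetry of \<open>E\<close> and \<open>A\<close> supplies the adjacencies in the
  direction that \<open>adj\<close> does not mention; a loop at \<open>v\<close> is
  excluded.\<close>

lemma partial_model_extend:
  assumes "partial_model E U A L S B" "v \<notin> S" "sym E" "sym A" "(v, v) \<notin> A"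
    and "C \<subseteq> U - \<Union>(B ` S)" "rel_connected E C" "card C \<le> L * Suc (card (A `` {v}))"
    and adj: "\<And>u. u \<in> S \<Longrightarrow> (v, u) \<in> A \<Longrightarrow> \<exists>x\<in>B u. \<exists>y\<in>C. (x, y) \<in> E"
  shows "partial_model E U A L (insert v S) (B(v := C))"
  unfolding partial_model_def
proof (intro conjI)
  show "\<forall>u\<in>insert v S. (B(v := C)) u \<subseteq> U \<and> rel_connected E ((B(v := C)) u) \<and>
      card ((B(v := C)) u) \<le> L * Suc (card (A `` {u}))"
    using assms by (auto simp: partial_model_def)
  have "disjoint_family_on B S" using assms(1) by (simp add: partial_model_def)
  then show "disjoint_family_on (B(v := C)) (insert v S)"
    using assms(2,6) unfolding disjoint_family_on_def by auto
  show "\<forall>u\<in>insert v S. \<forall>w\<in>insert v S. (u, w) \<in> A \<longrightarrow>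
      (\<exists>x\<in>(B(v := C)) u. \<exists>y\<in>(B(v := C)) w. (x, y) \<in> E)"
  proof (intro ballI impI)
    fix u w assume uw: "u \<in> insert v S" "w \<in> insert v S" "(u, w) \<in> A"
    consider "u = v" "w \<in> S" "w \<noteq> v" | "w = v" "u \<in> S" "u \<noteq> v" | "u \<in> S" "w \<in> S" "u \<noteq> v" "w \<noteq> v"
      using uw assms(2,5) by auto
    then show "\<exists>x\<in>(B(v := C)) u. \<exists>y\<in>(B(v := C)) w. (x, y) \<in> E"
    proof cases
      case 1
      then show ?thesis using adj[of w] uw(3) \<open>sym E\<close> by (auto dest: symD)
    next
      case 2
      then show ?thesis using adj[of u] uw(3) \<open>sym A\<close> by (auto dest: symD)
    next
      case 3
      then show ?thesis using assms(1) uw(3) by (auto simp: partial_model_def)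
    qed
  qed
qed

section \<open>Discarded vertices and the embedding into an expander\<close>

text \<open>\<open>P\<close> stands for the occupied vertices, \<open>R\<close> for the discarded
  ones, and \<open>U - R - P\<close> is what is still free. The cap at half of \<open>U\<close>
  makes the expansion of \<open>U\<close> applicable to \<open>R\<close>.\<close>

definition waste :: "'a rel \<Rightarrow> 'a set \<Rightarrow> real \<Rightarrow> 'a set \<Rightarrow> 'a set \<Rightarrow> bool" where
  "waste E U \<gamma> P R \<longleftrightarrow> R \<subseteq> U \<and> R \<inter> P = {} \<and> 2 * card R \<le> card U \<and>
     real (card (nbhd E (U - R - P) R)) \<le> \<gamma> / 2 * real (card R)"

text \<open>Expansion gives \<open>R\<close> at least \<open>\<gamma> * card R\<close> neighbours;
  the free part holds at most half that many, and all others lie in \<open>P\<close>.\<close>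

lemma waste_card:
  assumes "expander E U \<gamma>" "finite U" "P \<subseteq> U" "waste E U \<gamma> P R"
  shows "\<gamma> / 2 * real (card R) \<le> real (card P)"
proof -
  have "\<gamma> * real (card R) \<le> real (card (nbhd E U R))"
    using assms unfolding expander_def waste_def by blast
  also have "card (nbhd E U R) \<le> card (nbhd E (U - R - P) R \<union> P)"
    using assms by (intro card_mono) (auto simp: nbhd_def intro: finite_subset)
  also have "\<dots> \<le> card (nbhd E (U - R - P) R) + card P" by (rule card_Un_le)
  finally show ?thesis using assms(4) by (simp add: waste_def)
qed

text \<open>Neighbourhoods are subadditive, and the free part does not grow because
  \<open>P \<subseteq> P' \<union> X\<close>. The two sets \<open>P\<close> and \<open>P'\<close>
  let one lemma serve both moves: \<open>X\<close> may be a branch set leaving \<open>P\<close>, or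
  a free set with \<open>P' = P\<close>.\<close>

lemma waste_absorb:
  assumes "waste E U \<gamma> P R" "finite U" "X \<subseteq> U - R" "P' \<subseteq> P" "X \<inter> P' = {}" "P \<subseteq> P' \<union> X"
    and "real (card (nbhd E (U - R - P) X)) \<le> \<gamma> / 2 * real (card X)"
    and "2 * (card R + card X) \<le> card U"
  shows "waste E U \<gamma> P' (R \<union> X)"
proof -
  have "finite X" "finite R" using assms by (auto simp: waste_def intro: finite_subset)
  then have card: "card (R \<union> X) = card R + card X"
    using assms(3) by (intro card_Un_disjoint) auto
  have "card (nbhd E (U - (R \<union> X) - P') (R \<union> X))
      \<le> card (nbhd E (U - R - P) R \<union> nbhd E (U - R - P) X)"
    using assms(2,6) by (intro card_mono) (auto simp: nbhd_def)
  also have "\<dots> \<le> card (nbhd E (U - R - P) R) + card (nbhd E (U - R - P) X)"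
    by (rule card_Un_le)
  finally have "real (card (nbhd E (U - (R \<union> X) - P') (R \<union> X)))
      \<le> \<gamma> / 2 * real (card (R \<union> X))"
    using assms(1,7) by (simp add: card waste_def algebra_simps)
  then show ?thesis using assms card by (auto simp: waste_def)
qed

text \<open>Occupying more vertices can only remove free neighbours of \<open>R\<close>.\<close>

lemma waste_shrink:
  assumes "waste E U \<gamma> P R" "finite U" "P \<subseteq> P'" "R \<inter> P' = {}"
  shows "waste E U \<gamma> P' R"
proof -
  have "card (nbhd E (U - R - P') R) \<le> card (nbhd E (U - R - P) R)"
    using assms(2,3) by (intro card_mono) (auto simp: nbhd_def)
  then show ?thesis using assms(1,4) by (auto simp: waste_def)
qed

text \<open>
  A state consists of a partial model and a waste set. Maximising first the size of the waste and
  then the number of vertices already embedded makes every available move impossible: discarding a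
  branch set without free neighbours, discarding a free set that expands badly, or embedding a
  further vertex.
\<close>

lemma expander_has_model:
  assumes "finite U" "U \<noteq> {}" "sym E" "expander E U \<gamma>" "0 < \<gamma>" "\<gamma> \<le> 1"
    and H: "finite V" "finite A" "A \<subseteq> V \<times> V" "sym A" "irrefl A"
    and \<rho>: "real (card U) \<le> (1 + \<gamma> / 2) ^ \<rho>"
    and small: "24 * real ((2 * \<rho> + 2) * (card V + card A)) \<le> \<gamma>\<^sup>2 * real (card U)"
  shows "\<exists>B. partial_model E U A (2 * \<rho> + 2) V B"
proof -
  define L where "L = 2 * \<rho> + 2"
  define T where "T = L * (card V + card A)"
  define state where
    "state = (\<lambda>(S, B, R). S \<subseteq> V \<and> partial_model E U A L S B \<and> waste E U \<gamma> (\<Union>(B ` S)) R)"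
  \<comment> \<open>Since \<open>card S \<le> card V\<close>, the weight \<open>Suc (card V)\<close>
    makes this a lexicographic order: one more discarded vertex outweighs any loss of embedded
    ones.\<close>
  define \<mu> where
    "\<mu> = (\<lambda>(S, B :: 'b \<Rightarrow> 'a set, R :: 'a set). card R * Suc (card V) + card (S :: 'b set))"
  have \<mu>_mono: "\<mu> (S, B, R) < \<mu> (S', B', R')" if "card R < card R'" "S \<subseteq> V" for S B R S' B' R'
  proof -
    have "card S \<le> card V" using that(2) H(1) by (rule card_mono[rotated])
    moreover have "Suc (card R) * Suc (card V) \<le> card R' * Suc (card V)"
      using that(1) by (intro mult_le_mono1) simp
    ultimately show ?thesis by (simp add: \<mu>_def)
  qed
  have "state ({}, \<lambda>_. {}, {})"
    by (simp add: state_def partial_model_def waste_def nbhd_def disjoint_family_on_def)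
  moreover have "\<forall>s. state s \<longrightarrow> \<mu> s < Suc (card U * Suc (card V) + card V)"
  proof (intro allI impI)
    fix s assume "state s"
    moreover obtain S B R where s: "s = (S, B, R)" by (cases s)
    ultimately have "S \<subseteq> V" "R \<subseteq> U" by (auto simp: state_def waste_def)
    then have "card S \<le> card V" "card R \<le> card U" using H(1) assms(1) by (auto intro: card_mono)
    then show "\<mu> s < Suc (card U * Suc (card V) + card V)"
      unfolding s \<mu>_def prod.case less_Suc_eq_le by (intro add_mono mult_le_mono1)
  qed
  ultimately obtain s where "state s" and max: "\<And>s'. state s' \<Longrightarrow> \<mu> s' \<le> \<mu> s"
    using ex_has_greatest_nat[of state _ \<mu> "Suc (card U * Suc (card V) + card V)"] by blast
  moreover obtain S B R where s: "s = (S, B, R)" by (cases s)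
  ultimately have st: "S \<subseteq> V" "partial_model E U A L S B" "waste E U \<gamma> (\<Union>(B ` S)) R"
    by (auto simp: state_def)
  define P where "P = \<Union>(B ` S)"
  define F where "F = U - R - P"
  have "P \<subseteq> U" using st(2) by (auto simp: P_def partial_model_def)
  have waste: "waste E U \<gamma> P R" using st(3) by (simp add: P_def)
  then have "R \<subseteq> U" "R \<inter> P = {}" by (auto simp: waste_def)
  have fin: "finite P" "finite R" "finite F" "finite S"
    using assms(1) H(1) st(1) \<open>P \<subseteq> U\<close> \<open>R \<subseteq> U\<close> by (auto intro: finite_subset simp: F_def)
  have T_small: "24 * real T \<le> \<gamma>\<^sup>2 * real (card U)"
    using small by (simp add: T_def L_def)
  have "card P \<le> T"
    using partial_model_card[OF st(2,1) H(1-3)] by (simp add: P_def T_def)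
  then have card_P: "real (card P) \<le> real T" by simp
  have "\<gamma>\<^sup>2 \<le> \<gamma>" using assms(5,6) by (simp add: power2_eq_square mult_left_le)
  have pos_U: "real (card U) > 0" using assms(1,2) by (simp add: card_gt_0_iff)
  have T_le: "24 * real T \<le> \<gamma> * real (card U)" "24 * real T \<le> real (card U)"
  proof -
    have "\<gamma>\<^sup>2 * real (card U) \<le> \<gamma> * real (card U)"
      using \<open>\<gamma>\<^sup>2 \<le> \<gamma>\<close> by (intro mult_right_mono) auto
    then show "24 * real T \<le> \<gamma> * real (card U)" using T_small by linarith
    moreover have "\<gamma> * real (card U) \<le> 1 * real (card U)"
      using assms(6) by (intro mult_right_mono) auto
    ultimately show "24 * real T \<le> real (card U)" by linarith
  qed
  \<comment> \<open>The waste has at most \<open>2 * T / \<gamma>\<close> vertices, and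
    \<open>24 * T\<close> is at most \<open>\<gamma>\<^sup>2 * card U\<close>; this yields the
    factor 12.\<close>
  have card_R: "12 * real (card R) \<le> \<gamma> * real (card U)"
  proof -
    have "\<gamma> / 2 * real (card R) \<le> real T"
      using waste_card[OF assms(4,1) \<open>P \<subseteq> U\<close> waste] card_P by linarith
    then have "\<gamma> * (12 * real (card R)) \<le> \<gamma> * (\<gamma> * real (card U))"
      using T_small by (simp add: power2_eq_square)
    then show ?thesis using assms(5) by simp
  qed
  have card_R': "12 * real (card R) \<le> real (card U)"
  proof -
    have "\<gamma> * real (card U) \<le> 1 * real (card U)"
      using assms(6) by (intro mult_right_mono) auto
    then show ?thesis using card_R by linarith
  qed
  have "F \<noteq> {}"
  proof
    assume "F = {}"
    then have "card U \<le> card (R \<union> P)" using fin by (intro card_mono) (auto simp: F_def)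
    also have "\<dots> \<le> card R + card P" by (rule card_Un_le)
    finally show False using card_R' card_P T_le(2) pos_U by linarith
  qed
  have "S = V"
  proof (rule ccontr)
    assume "S \<noteq> V"
    then obtain v where v: "v \<in> V" "v \<notin> S" using st(1) by blast
    \<comment> \<open>Otherwise \<open>B u\<close> could be moved into the waste and
      \<open>u\<close> dropped from \<open>S\<close>, which raises \<open>\<mu>\<close>.\<close>
    have free: "nbhd E F (B u) \<noteq> {}" if u: "u \<in> S" for u
    proof
      assume empty: "nbhd E F (B u) = {}"
      have Bu: "B u \<noteq> {}" "B u \<subseteq> P" "finite (B u)"
        using st(2) u fin(1) by (auto simp: partial_model_def rel_connected_def P_def intro: finite_subset)
      have "disjoint_family_on B S" using st(2) by (simp add: partial_model_def)
      then have disj: "B u \<inter> \<Union>(B ` (S - {u})) = {}"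
        using u by (auto dest: disjoint_family_onD)
      have "card (B u) \<le> card P" using Bu fin(1) by (intro card_mono)
      then have "real (card (B u)) \<le> real (card P)" by simp
      then have "real (2 * (card R + card (B u))) \<le> real (card U)"
        using card_R' card_P T_le(2) pos_U by simp
      then have size: "2 * (card R + card (B u)) \<le> card U" by (simp only: of_nat_le_iff)
      have "waste E U \<gamma> (\<Union>(B ` (S - {u}))) (R \<union> B u)"
      proof (rule waste_absorb[OF waste assms(1) _ _ disj _ _ size])
        show "B u \<subseteq> U - R" using Bu \<open>R \<inter> P = {}\<close> \<open>P \<subseteq> U\<close> by blast
        show "\<Union>(B ` (S - {u})) \<subseteq> P" "P \<subseteq> \<Union>(B ` (S - {u})) \<union> B u"
          unfolding P_def by blast+
        show "real (card (nbhd E (U - R - P) (B u))) \<le> \<gamma> / 2 * real (card (B u))"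
          using empty assms(5) by (simp add: F_def)
      qed
      then have "state (S - {u}, B, R \<union> B u)"
        using st partial_model_mono[OF st(2), of "S - {u}"] by (auto simp: state_def)
      moreover have "card R < card (R \<union> B u)"
        using Bu fin \<open>R \<inter> P = {}\<close> by (intro psubset_card_mono) auto
      ultimately show False using max \<mu>_mono[of R "R \<union> B u" S] st(1) s
        by (metis leD)
    qed
    have expand: "\<gamma> / 2 * real (card X) \<le> real (card (nbhd E F X))"
      if X: "X \<subseteq> F" "2 * card X \<le> card U" for X
    proof (rule ccontr)
      assume bad: "\<not> ?thesis"
      have finX: "finite X" using X(1) fin(3) by (rule finite_subset)
      show False
      proof (cases "4 * card X \<le> card U")
        \<comment> \<open>The cap on waste survives: \<open>card R\<close> is at most a twelfth and
          \<open>card X\<close> at most a quarter of \<open>card U\<close>.\<close>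
        case True
        have "waste E U \<gamma> P (R \<union> X)"
          using X(1) True card_R' bad by (intro waste_absorb[OF waste assms(1)]) (auto simp: F_def)
        then have "state (S, B, R \<union> X)" using st by (simp add: state_def P_def)
        moreover have "X \<noteq> {}" using bad by auto
        then have "card R < card (R \<union> X)"
          using X(1) fin finX by (intro psubset_card_mono) (auto simp: F_def)
        ultimately show False using max \<mu>_mono[of R "R \<union> X" S] st(1) s
          by (metis leD)
      next
        case False
        \<comment> \<open>Here \<open>X\<close> is too large to discard but expands well in
          \<open>U\<close>. Passing to \<open>F\<close> loses at most
          \<open>card R + card P\<close>, which is at most
          \<open>(1/12 + 1/24) * \<gamma> * card U\<close>, that is
          \<open>\<gamma> * card U / 8\<close>, whereas \<open>\<gamma> / 2 * card X\<close> exceeds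
          this value.\<close>
        have "X \<subseteq> U" using X(1) by (auto simp: F_def)
        then have "\<gamma> * real (card X) \<le> real (card (nbhd E U X))"
          using assms(4) X(2) by (auto simp: expander_def)
        also have "card (nbhd E U X) \<le> card (nbhd E F X \<union> (R \<union> P))"
          using fin by (intro card_mono) (auto simp: nbhd_def F_def)
        also have "real (card (nbhd E F X \<union> (R \<union> P)))
            \<le> real (card (nbhd E F X)) + real (card R) + real (card P)"
          using card_Un_le[of "nbhd E F X" "R \<union> P"] card_Un_le[of R P] by linarith
        finally have "\<gamma> / 2 * real (card X) < real (card R) + real (card P)"
          using bad by simp
        moreover have "\<gamma> * real (card U) < \<gamma> * (4 * real (card X))"
          using False assms(5) by (intro mult_strict_left_mono) auto
        ultimately show False using card_R card_P T_le(1) by linarith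
      qed
    qed
    have "\<exists>x. x \<in> nbhd E F (B u)" if "u \<in> S" for u using free[OF that] by blast
    then obtain f where f: "\<And>u. u \<in> S \<Longrightarrow> f u \<in> nbhd E F (B u)" by metis
    \<comment> \<open>The extra vertex \<open>w\<close> keeps \<open>W\<close> nonempty when
      \<open>v\<close> has no embedded neighbour; it accounts for the \<open>Suc\<close> in the
      budget.\<close>
    obtain w where "w \<in> F" using \<open>F \<noteq> {}\<close> by blast
    define W where "W = insert w (f ` (S \<inter> A `` {v}))"
    have "finite (A `` {v})" using H(2) by auto
    then have "card W \<le> Suc (card (A `` {v}))"
    proof -
      have "card (f ` (S \<inter> A `` {v})) \<le> card (A `` {v})"
        using \<open>finite (A `` {v})\<close>
        by (meson card_image_le card_mono finite_Int inf_le2 order_trans)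
      moreover have "card W \<le> Suc (card (f ` (S \<inter> A `` {v})))"
        unfolding W_def by (rule card_insert_le_m1) simp_all
      ultimately show ?thesis by linarith
    qed
    have "W \<subseteq> F" using f \<open>w \<in> F\<close> by (auto simp: W_def nbhd_def)
    \<comment> \<open>The threshold \<open>m\<close> of \<open>connecting_set\<close> is
      \<open>card U\<close>, the range in which \<open>expand\<close> was shown.\<close>
    have "card F \<le> card U" using assms(1) by (intro card_mono) (auto simp: F_def)
    then obtain C where C: "C \<subseteq> F" "rel_connected E C" "W \<subseteq> C" "card C \<le> L * card W"
      using connecting_set[OF fin(3) assms(3) _ _ \<rho> expand \<open>W \<subseteq> F\<close>] assms(5)
      by (auto simp: W_def L_def)
    have "partial_model E U A L (insert v S) (B(v := C))"
    proof (rule partial_model_extend[OF st(2) v(2) assms(3) H(4)])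
      show "(v, v) \<notin> A" using H(5) by (auto simp: irrefl_def)
      show "C \<subseteq> U - \<Union>(B ` S)" using C(1) by (auto simp: F_def P_def)
      show "card C \<le> L * Suc (card (A `` {v}))"
        using C(4) \<open>card W \<le> _\<close> by (meson mult_le_mono2 order_trans)
      show "\<exists>x\<in>B u. \<exists>y\<in>C. (x, y) \<in> E" if "u \<in> S" "(v, u) \<in> A" for u
        using f[OF that(1)] C(3) that by (auto simp: W_def nbhd_def)
    qed (fact C(2))
    moreover have "\<Union>((B(v := C)) ` insert v S) = P \<union> C"
      using v(2) by (auto simp: P_def)
    moreover have "waste E U \<gamma> (P \<union> C) R"
      using waste_shrink[OF waste assms(1), of "P \<union> C"] C(1) \<open>R \<inter> P = {}\<close> by (auto simp: F_def)
    ultimately have "state (insert v S, B(v := C), R)"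
      using st(1) v(1) unfolding state_def prod.case by (metis insert_subset)
    then have "\<mu> (insert v S, B(v := C), R) \<le> \<mu> (S, B, R)" using max s by blast
    then show False using fin(4) v(2) by (simp add: \<mu>_def)
  qed
  then show ?thesis using st(2) by (auto simp: L_def)
qed

section \<open>Edge and arc counts in finite simple graphs\<close>

lemma (in pair_graph) sym_parcs: "sym (parcs G)"
  using pair_sym_arcs by (simp add: symmetric_def)

lemma (in pair_graph) irrefl_parcs: "irrefl (parcs G)"
  using pair_no_loops by (fastforce simp: irrefl_def)

lemma (in pair_graph) finite_edges: "finite (edges G)"
proof -
  have "edges G = (\<lambda>(u, v). {u, v}) ` parcs G" by (auto simp: edges_def)
  then show ?thesis using pair_finite_arcs by simp
qed

lemma (in pair_graph) card_edges_le: "card (edges G) \<le> card (pverts G) choose 2"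
proof -
  have "edges G \<subseteq> {e. e \<subseteq> pverts G \<and> card e = 2}"
    using in_arcsD1 in_arcsD2 pair_no_loops by (fastforce simp: edges_def card_2_iff)
  then have "card (edges G) \<le> card {e. e \<subseteq> pverts G \<and> card e = 2}"
    using pair_finite_verts by (intro card_mono) auto
  then show ?thesis by (simp add: n_subsets pair_finite_verts)
qed

text \<open>An unordered pair arises from at most two arcs. The embedding counts arcs of
  \<open>H\<close>, while the hypothesis on \<open>H\<close> counts edges.\<close>

lemma (in pair_graph) card_parcs_le: "card (parcs G) \<le> 2 * card (edges G)"
proof -
  have le2: "card {(u, v). {u, v} = e} \<le> 2 \<and> finite {(u, v). {u, v} = e}"
    if e: "e \<in> edges G" for e
  proof -
    obtain a b where "e = {a, b}" using e by (auto simp: edges_def)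
    then have sub: "{(u, v). {u, v} = e} \<subseteq> {(a, b), (b, a)}" by (auto simp: doubleton_eq_iff)
    have "card {(a, b), (b, a)} \<le> 2" by (rule card_insert_le_m1) simp_all
    have "finite {(a, b), (b, a)}" by simp
    then show ?thesis
      using \<open>card {(a, b), (b, a)} \<le> 2\<close> card_mono[OF _ sub] finite_subset[OF sub]
      by (meson order_trans)
  qed
  have "card (parcs G) \<le> card (\<Union>e\<in>edges G. {(u, v). {u, v} = e})"
    using finite_edges le2 by (intro card_mono) (auto simp: edges_def)
  also have "\<dots> \<le> (\<Sum>e\<in>edges G. card {(u, v). {u, v} = e})"
    by (rule card_UN_le[OF finite_edges])
  also have "\<dots> \<le> (\<Sum>e\<in>edges G. 2)" using le2 by (intro sum_mono) auto
  finally show ?thesis by simp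
qed

text \<open>By symmetry of the arcs, each edge at \<open>y\<close> comes from an arc leaving
  \<open>y\<close>.\<close>

lemma (in pair_graph) card_incident_edges_le:
  "card {e \<in> edges G. y \<in> e} \<le> out_degree (with_proj G) y"
proof -
  have "{e \<in> edges G. y \<in> e} \<subseteq> (\<lambda>(u, v). {u, v}) ` out_arcs (with_proj G) y"
    using sym_parcs by (fastforce simp: edges_def out_arcs_def dest: symD)
  moreover have "finite (out_arcs (with_proj G) y)"
    using pair_finite_arcs by (simp add: out_arcs_def)
  ultimately show ?thesis
    unfolding out_degree_def by (meson card_image_le card_mono finite_imageI order_trans)
qed

section \<open>Extracting an expander from a locally sparse graph\<close>

text \<open>
  Take a minimal nonempty set spanning at least \<open>c2 u + (c1 - c2) u\<^sup>2 / n\<close> edges, where \<open>u\<close> is its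
  size. Neither part of a partition into sizes \<open>x\<close> and \<open>u - x\<close> satisfies this bound, and the
  quadratic term being superadditive, at least \<open>2 (c1 - c2) x (u - x) / n\<close> edges cross.
\<close>

lemma locally_sparse_contains_expander:
  assumes G: "c1_c2_alpha_graph c1 c2 \<alpha> G" and \<Delta>: "max_degree_at_most G \<Delta>"
    and "c1 > c2" "c2 > 0" "0 < \<alpha>" "\<Delta> > 0"
  shows "\<exists>U\<subseteq>pverts G. U \<noteq> {} \<and> \<alpha> * real (card (pverts G)) \<le> real (card U) \<and>
           expander (parcs G) U ((c1 - c2) * \<alpha> / \<Delta>)"
proof -
  interpret pair_graph G using G by (simp add: c1_c2_alpha_graph_def)
  define n where "n = real (card (pverts G))"
  \<comment> \<open>The quadratic coefficient is chosen so that \<open>h n = c1 * n\<close>, which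
    makes the whole vertex set heavy. As \<open>h x \<ge> c2 * x\<close>, local sparsity rules out
    heavy sets of size at most \<open>\<alpha> * n\<close>.\<close>
  define h where "h = (\<lambda>x :: real. c2 * x + (c1 - c2) * x\<^sup>2 / n)"
  define e where "e = (\<lambda>W. real (card (spanned_edges G W)))"
  define heavy where
    "heavy = (\<lambda>W. W \<subseteq> pverts G \<and> W \<noteq> {} \<and> h (real (card W)) \<le> e W)"
  have fin_sp: "finite (spanned_edges G W)" for W
    using finite_edges by (simp add: spanned_edges_def)
  have dense: "c1 \<le> real (card (edges G)) / n" "n > 0"
  proof -
    show *: "c1 \<le> real (card (edges G)) / n"
      using G by (simp add: c1_c2_alpha_graph_def n_def)
    show "n > 0"
    proof (rule ccontr)
      assume "\<not> ?thesis"
      then have "n = 0" by (simp add: n_def)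
      \<comment> \<open>Division by zero yields 0, so \<open>n = 0\<close> would force
        \<open>c1 \<le> 0\<close>.\<close>
      then show False using * assms(3,4) by simp
    qed
  qed
  have "heavy (pverts G)"
  proof -
    have "spanned_edges G (pverts G) = edges G"
      using in_arcsD1 in_arcsD2 by (auto simp: spanned_edges_def edges_def)
    then have "c1 * n \<le> e (pverts G)" using dense by (simp add: e_def field_simps)
    moreover have "h n = c1 * n"
      using dense(2) by (simp add: h_def power2_eq_square field_simps)
    ultimately show ?thesis using dense(2) by (auto simp: heavy_def n_def)
  qed
  then obtain U where U: "heavy U" and min: "\<And>W. heavy W \<Longrightarrow> card U \<le> card W"
    using ex_has_least_nat[of heavy "pverts G" card] by blast
  have "U \<subseteq> pverts G" "U \<noteq> {}" using U by (auto simp: heavy_def)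
  then have "finite U" using pair_finite_verts by (blast intro: finite_subset)
  have "\<alpha> * n < real (card U)"
  proof (rule ccontr)
    assume "\<not> ?thesis"
    then have "e U < c2 * real (card U)"
      using G \<open>U \<subseteq> pverts G\<close> \<open>U \<noteq> {}\<close> by (simp add: c1_c2_alpha_graph_def n_def e_def)
    moreover have "c2 * real (card U) \<le> h (real (card U))"
      using dense(2) assms(3) by (simp add: h_def)
    ultimately show False using U by (simp add: heavy_def)
  qed
  moreover have "expander (parcs G) U ((c1 - c2) * \<alpha> / \<Delta>)"
    unfolding expander_def
  proof (intro allI impI)
    fix X assume X: "X \<subseteq> U" "2 * card X \<le> card U"
    show "(c1 - c2) * \<alpha> / \<Delta> * real (card X) \<le> real (card (nbhd (parcs G) U X))"
    proof (cases "X = {}")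
      case False
      define x where "x = real (card X)"
      define u where "u = real (card U)"
      have "finite X" using X(1) \<open>finite U\<close> by (rule finite_subset)
      then have "card X > 0" using False by (simp add: card_gt_0_iff)
      have x: "x > 0" "2 * x \<le> u" "real (card (U - X)) = u - x"
        using X \<open>card X > 0\<close> \<open>finite X\<close> \<open>finite U\<close>
        by (auto simp: x_def u_def card_Diff_subset of_nat_diff card_mono)
      have light: "e W < h (real (card W))" if "W \<subseteq> U" "W \<noteq> {}" "card W < card U" for W
        using min[of W] that \<open>U \<subseteq> pverts G\<close> by (force simp: heavy_def)
      have "card (U - X) > 0" "card (U - X) < card U" "card X < card U"
        using X \<open>card X > 0\<close> \<open>finite X\<close> by (simp_all add: card_Diff_subset)
      then have "U - X \<noteq> {}" by (metis card.empty less_irrefl)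
      then have lightX: "e X < h x" "e (U - X) < h (u - x)"
        using light[OF X(1) False \<open>card X < card U\<close>]
          light[OF Diff_subset _ \<open>card (U - X) < card U\<close>] x(3)
        by (simp_all add: x_def)
      \<comment> \<open>These are the edges of \<open>U\<close> crossing between \<open>X\<close>
        and \<open>U - X\<close>.\<close>
      define K where "K = spanned_edges G U - spanned_edges G X - spanned_edges G (U - X)"
      have "card (spanned_edges G U)
          \<le> card (spanned_edges G X \<union> spanned_edges G (U - X) \<union> K)"
        using fin_sp by (intro card_mono) (auto simp: K_def)
      also have "\<dots> \<le> card (spanned_edges G X) + card (spanned_edges G (U - X)) + card K"
        by (meson add_le_mono1 card_Un_le order_trans)
      finally have "e U \<le> e X + e (U - X) + real (card K)" by (simp add: e_def)
      moreover have "h u \<le> e U" using U by (simp add: heavy_def u_def)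
      ultimately have "h u - h x - h (u - x) \<le> real (card K)" using lightX by linarith
      moreover have "h u - h x - h (u - x) = 2 * (c1 - c2) * x * (u - x) / n"
        using dense(2) by (simp add: h_def field_simps power2_eq_square)
      moreover have "(c1 - c2) * \<alpha> * x \<le> 2 * (c1 - c2) * x * (u - x) / n"
      proof -
        \<comment> \<open>\<open>X\<close> is at most half of \<open>U\<close>, so
          \<open>2 * (u - x) \<ge> u\<close>, and \<open>u > \<alpha> * n\<close>.\<close>
        have "\<alpha> * n \<le> 2 * (u - x)" using \<open>\<alpha> * n < real (card U)\<close> x(2) by (simp add: u_def)
        then have "((c1 - c2) * x) * (\<alpha> * n) \<le> ((c1 - c2) * x) * (2 * (u - x))"
          using assms(3) x(1) by (intro mult_left_mono) auto
        then show ?thesis using dense(2) by (simp add: field_simps)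
      qed
      ultimately have "(c1 - c2) * \<alpha> * x \<le> real (card K)" by linarith
      also have "real (card K) \<le> \<Delta> * real (card (nbhd (parcs G) U X))"
      proof -
        let ?N = "nbhd (parcs G) U X"
        \<comment> \<open>The endpoint of a crossing edge outside \<open>X\<close> lies in the
          neighbourhood of \<open>X\<close>, and each such vertex meets at most
          \<open>\<Delta>\<close> edges.\<close>
        have "K \<subseteq> (\<Union>y\<in>?N. {e \<in> edges G. y \<in> e})"
        proof
          fix d assume d: "d \<in> K"
          then obtain a b where ab: "d = {a, b}" "(a, b) \<in> parcs G"
            by (auto simp: K_def spanned_edges_def edges_def)
          then have "(b, a) \<in> parcs G" using sym_parcs by (auto dest: symD)
          then have "a \<in> ?N \<or> b \<in> ?N"
            using d ab by (auto simp: K_def spanned_edges_def nbhd_def)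
          then show "d \<in> (\<Union>y\<in>?N. {e \<in> edges G. y \<in> e})"
            using d ab(1) by (auto simp: K_def spanned_edges_def)
        qed
        then have "card K \<le> card (\<Union>y\<in>?N. {e \<in> edges G. y \<in> e})"
          using finite_edges finite_nbhd[OF \<open>finite U\<close>] by (intro card_mono) auto
        also have "\<dots> \<le> (\<Sum>y\<in>?N. card {e \<in> edges G. y \<in> e})"
          by (rule card_UN_le[OF finite_nbhd[OF \<open>finite U\<close>]])
        finally have "real (card K) \<le> (\<Sum>y\<in>?N. real (card {e \<in> edges G. y \<in> e}))"
          by (simp flip: of_nat_sum)
        also have "\<dots> \<le> (\<Sum>y\<in>?N. \<Delta>)"
        proof (rule sum_mono)
          fix y assume "y \<in> ?N"
          then have "y \<in> pverts G" using \<open>U \<subseteq> pverts G\<close> by (auto simp: nbhd_def)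
          then have "real (out_degree (with_proj G) y) \<le> \<Delta>"
            using \<Delta> by (simp add: max_degree_at_most_def)
          then show "real (card {e \<in> edges G. y \<in> e}) \<le> \<Delta>"
            using card_incident_edges_le[of y] by linarith
        qed
        finally show ?thesis by (simp add: mult.commute)
      qed
      finally show ?thesis using \<open>\<Delta> > 0\<close> by (simp add: x_def field_simps)
    qed simp
  qed
  ultimately show ?thesis using \<open>U \<subseteq> pverts G\<close> \<open>U \<noteq> {}\<close> by (auto simp: n_def intro!: exI[of _ U])
qed

section \<open>From relational models to graph minors, and the choice of the exponent\<close>

text \<open>Library connectedness is strong connectedness of the symmetric closure; walks inside
  \<open>C\<close> use only arcs of the induced subgraph, which the closure keeps.\<close>

lemma connected_induce_subgraph:
  assumes "rel_connected (parcs G) C"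
  shows "Digraph_Component.connected (with_proj G \<restriction> C)"
proof -
  let ?E = "parcs (mk_symmetric (with_proj G \<restriction> C))"
  have "(x, y) \<in> rtrancl_on C ?E" if "(x, y) \<in> rtrancl_on C (parcs G)" for x y
    using that
  proof (induction rule: rtrancl_on_induct)
    case (step y z)
    then have "(y, z) \<in> ?E" by (force simp: parcs_mk_symmetric)
    then show ?case using step by (blast intro: rtrancl_on_into_rtrancl_on)
  qed auto
  then show ?thesis
    using assms
    by (auto simp: Digraph_Component.connected_def strongly_connected_def reachable_def rel_connected_def)
qed

lemma partial_model_imp_has_minor:
  assumes "partial_model (parcs G) U (parcs H) L (pverts H) B" "U \<subseteq> pverts G" "pair_graph H"
  shows "has_minor G H"
proof -
  interpret H: pair_graph H by (fact assms(3))
  have "(\<forall>u\<in>pverts H. B u \<subseteq> pverts G \<and> Digraph_Component.connected (with_proj G \<restriction> B u)) \<and>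
        disjoint_family_on B (pverts H) \<and>
        (\<forall>u v. (u, v) \<in> parcs H \<longrightarrow> (\<exists>x\<in>B u. \<exists>y\<in>B v. (x, y) \<in> parcs G))"
    using assms(1,2) H.in_arcsD1 H.in_arcsD2 unfolding partial_model_def
    by (blast intro: connected_induce_subgraph)
  then show ?thesis unfolding has_minor_def by blast
qed

theorem corollary2:
  fixes c1 c2 \<alpha> \<Delta> :: real
  assumes "c1 > c2" and "c2 > 1" and "0 < \<alpha>" and "\<alpha> < 1" and "\<Delta> > 0"
  shows "\<exists>\<kappa>::real. \<kappa> > 0 \<and>
    (\<forall>(G :: 'a pair_pre_digraph) (n :: nat).
       c1_c2_alpha_graph c1 c2 \<alpha> G \<and> card (pverts G) = n \<and> max_degree_at_most G \<Delta> \<longrightarrow>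
       (\<forall>H :: 'b pair_pre_digraph.
          pair_graph H \<and>
          real (card (pverts H)) \<le> real n / (ln (real n)) powr \<kappa> \<and>
          real (card (edges H)) \<le> real n / (ln (real n)) powr \<kappa> \<longrightarrow>
          has_minor G H))"
proof -
  \<comment> \<open>The cap at 1 meets the requirement of \<open>expander_has_model\<close>;
    lowering the rate preserves expansion.\<close>
  define \<gamma> where "\<gamma> = min 1 ((c1 - c2) * \<alpha> / \<Delta>)"
  define l where "l = ln (1 + \<gamma> / 2)"
  \<comment> \<open>72 is 24 times 3, the 3 coming from one vertex count plus two arcs per edge;
    \<open>2 / l + 4\<close> bounds \<open>(2 * \<rho> + 2) / ln n\<close>.\<close>
  define K where "K = 72 * (2 / l + 4) / (\<gamma>\<^sup>2 * \<alpha>)"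
  \<comment> \<open>One power of the logarithm pays for the branch set sizes. The excess satisfies
    \<open>(ln 4) powr (\<kappa> - 1) = 1 + K\<close>, so it absorbs the constant \<open>K\<close>
    for every \<open>n \<ge> 4\<close>; taking \<open>1 + K\<close> rather than \<open>K\<close>
    makes the excess positive.\<close>
  define \<kappa> where "\<kappa> = 1 + ln (1 + K) / ln (ln (4 :: real))"
  have \<gamma>: "0 < \<gamma>" "\<gamma> \<le> 1" using assms by (auto simp: \<gamma>_def)
  then have "l > 0" by (simp add: l_def)
  then have "K > 0" using \<gamma> assms by (simp add: K_def add_pos_pos)
  have ln4: "ln (4 :: real) > 1"
  proof -
    have "exp (1 :: real) < 4" using exp_le by linarith
    then have "ln (exp 1) < ln (4 :: real)" by (intro ln_less_cancel_iff[THEN iffD2]) auto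
    then show ?thesis by simp
  qed
  have "\<kappa> > 0" using \<open>K > 0\<close> ln4 by (simp add: \<kappa>_def add_pos_pos)
  moreover have "has_minor G H"
    if G: "c1_c2_alpha_graph c1 c2 \<alpha> G" "card (pverts G) = n" "max_degree_at_most G \<Delta>"
      and H: "pair_graph H" "real (card (pverts H)) \<le> real n / (ln (real n)) powr \<kappa>"
        "real (card (edges H)) \<le> real n / (ln (real n)) powr \<kappa>"
    for G :: "'a pair_pre_digraph" and H :: "'b pair_pre_digraph" and n
  proof -
    interpret G: pair_graph G using G(1) by (simp add: c1_c2_alpha_graph_def)
    interpret H: pair_graph H by (fact H(1))
    have density: "c1 \<le> real (card (edges G)) / real n"
      using G(1,2) by (simp add: c1_c2_alpha_graph_def)
    then have "n > 0" using assms(1,2) by (cases "n = 0") auto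
    then have "n < card (edges G)"
      using density assms(1,2)
      by (simp add: le_divide_eq)
        (smt (verit) mult_less_cancel_right1 of_nat_0_less_iff of_nat_less_iff)
    then have "n < n choose 2" using G.card_edges_le G(2) by simp
    then have "n < n * (n - 1) div 2" by (simp add: choose_two)
    \<comment> \<open>More edges than vertices is impossible for a simple graph on at most three
      vertices. This gives \<open>ln n \<ge> ln 4 > 1\<close>, so no separate treatment of small
      \<open>n\<close> is required.\<close>
    have "n \<ge> 4"
    proof (rule ccontr)
      assume "\<not> ?thesis"
      then have "n \<in> {0, 1, 2, 3}" by auto
      then show False using \<open>n < n * (n - 1) div 2\<close> by auto
    qed
    define t where "t = ln (real n)"
    have "ln 4 \<le> t" using \<open>n \<ge> 4\<close> by (simp add: t_def)
    then have "t > 1" using ln4 by linarith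
    have t_powr: "t powr \<kappa> = t * t powr (\<kappa> - 1)" "K \<le> t powr (\<kappa> - 1)"
    proof -
      show "t powr \<kappa> = t * t powr (\<kappa> - 1)"
        using \<open>t > 1\<close> powr_add[of t 1 "\<kappa> - 1"] by simp
      have "K \<le> (ln 4) powr (\<kappa> - 1)"
        using ln4 \<open>K > 0\<close> by (simp add: \<kappa>_def powr_def)
      also have "\<dots> \<le> t powr (\<kappa> - 1)"
        using \<open>ln 4 \<le> t\<close> ln4 \<open>K > 0\<close> by (intro powr_mono2) (auto simp: \<kappa>_def)
      finally show "K \<le> t powr (\<kappa> - 1)" .
    qed
    obtain U where U: "U \<subseteq> pverts G" "U \<noteq> {}" "\<alpha> * real n \<le> real (card U)"
      "expander (parcs G) U ((c1 - c2) * \<alpha> / \<Delta>)"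
      using locally_sparse_contains_expander[OF G(1,3)] assms G(2) by auto
    have "finite U" using U(1) G.pair_finite_verts by (rule finite_subset)
    have "expander (parcs G) U \<gamma>"
      unfolding expander_def
    proof (intro allI impI)
      fix X assume "X \<subseteq> U" "2 * card X \<le> card U"
      then have "(c1 - c2) * \<alpha> / \<Delta> * real (card X) \<le> real (card (nbhd (parcs G) U X))"
        using U(4) by (simp add: expander_def)
      moreover have "\<gamma> * real (card X) \<le> (c1 - c2) * \<alpha> / \<Delta> * real (card X)"
        by (intro mult_right_mono) (auto simp: \<gamma>_def)
      ultimately show "\<gamma> * real (card X) \<le> real (card (nbhd (parcs G) U X))" by linarith
    qed
    \<comment> \<open>This is the least radius with \<open>exp (\<rho> * l) \<ge> n\<close>, where
      \<open>exp l\<close> is the growth factor \<open>1 + \<gamma> / 2\<close>.\<close>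
    define \<rho> where "\<rho> = nat \<lceil>t / l\<rceil>"
    have \<rho>: "t / l \<le> real \<rho>" "real \<rho> \<le> t / l + 1"
    proof -
      have "t / l > 0" using \<open>t > 1\<close> \<open>l > 0\<close> by simp
      then show "t / l \<le> real \<rho>" "real \<rho> \<le> t / l + 1" unfolding \<rho>_def by linarith+
    qed
    have "real (card U) \<le> real n"
      using card_mono[OF G.pair_finite_verts U(1)] G(2) by simp
    also have "real n = exp t" using \<open>n > 0\<close> by (simp add: t_def)
    also have "\<dots> \<le> exp (real \<rho> * l)" using \<rho>(1) \<open>l > 0\<close> by (simp add: field_simps)
    also have "\<dots> = (1 + \<gamma> / 2) ^ \<rho>" using \<gamma>(1) by (simp add: l_def exp_of_nat_mult)
    finally have \<rho>_big: "real (card U) \<le> (1 + \<gamma> / 2) ^ \<rho>" .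
    have "24 * real ((2 * \<rho> + 2) * (card (pverts H) + card (parcs H))) \<le> \<gamma>\<^sup>2 * real (card U)"
    proof -
      have "real (card (parcs H)) \<le> 2 * real (card (edges H))" using H.card_parcs_le by linarith
      then have "real (card (pverts H) + card (parcs H)) \<le> 3 * (real n / t powr \<kappa>)"
        using H(2,3) by (simp add: t_def)
      moreover have "real (2 * \<rho> + 2) \<le> (2 / l + 4) * t"
      proof -
        \<comment> \<open>Rounding up gives \<open>2 * (t / l) + 4\<close>, and \<open>t > 1\<close>
          turns the 4 into \<open>4 * t\<close>.\<close>
        have "real (2 * \<rho> + 2) \<le> 2 * (t / l) + 4 * t" using \<rho>(2) \<open>t > 1\<close> by simp
        then show ?thesis by (simp add: algebra_simps)
      qed
      ultimately have "24 * (real (2 * \<rho> + 2) * real (card (pverts H) + card (parcs H)))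
          \<le> 24 * (((2 / l + 4) * t) * (3 * (real n / t powr \<kappa>)))"
        using \<open>t > 1\<close> \<open>l > 0\<close> by (intro mult_left_mono mult_mono) auto
      also have "\<dots> = 72 * (2 / l + 4) * real n / t powr (\<kappa> - 1)"
        using \<open>t > 1\<close> by (simp add: t_powr(1))
      also have "\<dots> = K / t powr (\<kappa> - 1) * (\<gamma>\<^sup>2 * (\<alpha> * real n))"
        using \<gamma>(1) assms(3) by (simp add: K_def)
      also have "\<dots> \<le> 1 * (\<gamma>\<^sup>2 * (\<alpha> * real n))"
        using t_powr(2) \<open>t > 1\<close> assms(3) by (intro mult_right_mono) auto
      also have "\<dots> \<le> \<gamma>\<^sup>2 * real (card U)" using U(3) by (simp add: mult_left_mono)
      finally show ?thesis by (simp only: of_nat_mult)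
    qed
    moreover have "parcs H \<subseteq> pverts H \<times> pverts H" using H.in_arcsD1 H.in_arcsD2 by auto
    ultimately obtain B where "partial_model (parcs G) U (parcs H) (2 * \<rho> + 2) (pverts H) B"
      using expander_has_model[OF \<open>finite U\<close> U(2) G.sym_parcs \<open>expander (parcs G) U \<gamma>\<close> \<gamma>
          H.pair_finite_verts H.pair_finite_arcs _ H.sym_parcs H.irrefl_parcs \<rho>_big] by blast
    then show ?thesis using U(1) H(1) by (rule partial_model_imp_has_minor)
  qed
  ultimately show ?thesis by blast
qed

end
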